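(* Let $\mathsf{dist}$ be a generalized distance on $\mathcal P(\mathbb Z_+)$ satisfying the decomposition property and the sandwich property. Let $Y_1,\dots,Y_n$ be i.i.d. from $f_G$, let $p_n^{\mathsf{emp}}=\frac1n\sum_{i=1}^n\delta_{Y_i}$, and let $\hat G=\operatorname{argmin}_{Q\in\mathcal P(\mathbb R_+)}\mathsf{dist}(p_n^{\mathsf{emp}}\,\|\,f_Q)$ be the unconstrained minimum-distance estimator. Then there exist constants $c_1,c_2$ such that for all $h>0$ and $s>0$: (a) $\displaystyle\sup_{G\in\mathcal P([0,h])}\mathbb E\left[H^2(f_G,f_{\hat G})\right]\le\frac{c_1}{n}\min\left\{\max\{1,h\}\frac{\log n}{\log\log n},\ h+\log n\right\}$ for any $n\ge3$; (b) $\displaystyle\sup_{G\in\mathsf{SubE}(s)}\mathbb E\left[H^2(f_G,f_{\hat G})\right]\le\frac{c_2\max\{1,s\}}{n}\log n$ for any $n\ge2$.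
   Context: $\mathbb Z_+=\{0,1,2,\dots\}$, $\mathbb R_+=[0,\infty)$. For a Borel set $\Theta\subset\mathbb R$, $\mathcal P(\Theta)$ is the set of Borel probability measures on $\Theta$; $\mathcal P(\mathbb Z_+)$ is the set of probability mass functions on $\mathbb Z_+$. $\mathsf{SubE}(s)=\{G\in\mathcal P(\mathbb R_+):G([t,\infty))\le 2e^{-t/s}\ \forall t>0\}$. For $G\in\mathcal P(\mathbb R_+)$ the Poisson mixture is $f_G(y)=\int e^{-\theta}\frac{\theta^y}{y!}\,G(d\theta)$, $y\in\mathbb Z_+$ (with $0^0=1$). Squared Hellinger distance: $H^2(p,q)=\sum_{y\ge0}(\sqrt{p(y)}-\sqrt{q(y)})^2$; $\chi^2(p\|q)=\sum_{y\ge0}\frac{(p(y)-q(y))^2}{q(y)}$. A generalized distance is a map $\mathsf{dist}:\mathcal P(\mathbb Z_+)\times\mathcal P(\mathbb Z_+)\to[0,\infty]$ with $\mathsf{dist}(p\|q)\ge 0$ and equality if and only if $p=q$. Decomposition property: there exist maps $t:\mathcal P(\mathbb Z_+)\to\mathbb R$ and $\ell:[0,\infty)^2\to(-\infty,\infty]$, with $\ell(a,b)$ finite for $b>0$, such that for all $q_1,q_2\in\mathcal P(\mathbb Z_+)$, $\mathsf{dist}(q_1\|q_2)=t(q_1)+\sum_{y\ge0}\ell(q_1(y),q_2(y))$, where $b\mapsto\ell(a,b)$ is strictly decreasing and strictly convex (and continuous on $[0,\infty)$ as an extended-real-valued function) for each $a>0$, and $\ell(0,b)=0$ for all $b\ge0$.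 (Under this property the minimizer $\hat G$ exists and is unique.) Sandwich property: there exist absolute constants $\kappa_1,\kappa_2>0$ such that $\kappa_1H^2(q_1,q_2)\le\mathsf{dist}(q_1\|q_2)\le\kappa_2\chi^2(q_1\|q_2)$ for all $q_1,q_2\in\mathcal P(\mathbb Z_+)$. The constants $c_1,c_2$ in the claim may depend on $\mathsf{dist}$ (through $\kappa_1,\kappa_2$) but not on $h,s,n$. *)

theory Defs
  imports "HOL-Probability.Probability"
begin

text \<open>
  Probability mass functions on the nonnegative integers are elements of \<^typ>\<open>nat pmf\<close>.
  A Borel probability measure on a Borel set of reals is represented by the Borel probability
  measure on the whole line that gives the set mass one; two such measures are equal as elements
  of \<^typ>\<open>real measure\<close> iff they agree on all Borel sets.
\<close>

definition prob_measures_on :: "real set \<Rightarrow> real measure set" where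
  "prob_measures_on \<Theta> = {G. real_distribution G \<and> measure G \<Theta> = 1}"

definition SubE :: "real \<Rightarrow> real measure set" where
  "SubE s = {G \<in> prob_measures_on {0..}. \<forall>t>0. measure G {t..} \<le> 2 * exp (- t / s)}"

text \<open>
  The function passed to \<^const>\<open>embed_pmf\<close> is a probability mass function whenever the mixing
  measure lives on the nonnegative half-line; see \<open>pmf_poisson_mixture\<close> below.
\<close>

definition poisson_mixture :: "real measure \<Rightarrow> nat pmf" where
  "poisson_mixture G = embed_pmf (\<lambda>y. LINT \<theta>|G. exp (- \<theta>) * \<theta> ^ y / fact y)"

definition hellinger_sq :: "nat pmf \<Rightarrow> nat pmf \<Rightarrow> ennreal" where
  "hellinger_sq p q = (\<Sum>y. ennreal ((sqrt (pmf p y) - sqrt (pmf q y))\<^sup>2))"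

text \<open>
  The division is the one on \<^typ>\<open>ennreal\<close>, not on \<^typ>\<open>real\<close>: a term with zero
  denominator is infinite if its numerator is positive, and zero otherwise.
\<close>

definition chi_sq :: "nat pmf \<Rightarrow> nat pmf \<Rightarrow> ennreal" where
  "chi_sq p q = (\<Sum>y. ennreal ((pmf p y - pmf q y)\<^sup>2) / ennreal (pmf q y))"

definition generalized_distance :: "(nat pmf \<Rightarrow> nat pmf \<Rightarrow> ennreal) \<Rightarrow> bool" where
  "generalized_distance d \<longleftrightarrow> (\<forall>p q. d p q = 0 \<longleftrightarrow> p = q)"

text \<open>
  Only the values of \<open>l\<close> at nonnegative arguments are relevant.  The series is the limit of its
  partial sums in the extended reals; no term of it is \<open>-\<infinity>\<close>, so neither the partial
  sums nor the convex combinations below meet an indeterminate form.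
\<close>

definition decomposition_property :: "(nat pmf \<Rightarrow> nat pmf \<Rightarrow> ennreal) \<Rightarrow> bool" where
  "decomposition_property d \<longleftrightarrow>
    (\<exists>(t :: nat pmf \<Rightarrow> real) (l :: real \<Rightarrow> real \<Rightarrow> ereal).
      (\<forall>a\<ge>0. \<forall>b\<ge>0. l a b \<noteq> -\<infinity>) \<and>
      (\<forall>a\<ge>0. \<forall>b>0. l a b \<noteq> \<infinity>) \<and>
      (\<forall>q1 q2. \<exists>S. (\<lambda>y. l (pmf q1 y) (pmf q2 y)) sums S \<and>
                   enn2ereal (d q1 q2) = ereal (t q1) + S) \<and>
      (\<forall>a>0. strict_antimono_on {0..} (l a)) \<and>
      (\<forall>a>0. \<forall>b\<ge>0. \<forall>b'\<ge>0. \<forall>u. b \<noteq> b' \<and> 0 < u \<and> u < 1 \<longrightarrow>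
        l a ((1 - u) * b + u * b') < ereal (1 - u) * l a b + ereal u * l a b') \<and>
      (\<forall>a>0. continuous_on {0..} (l a)) \<and>
      (\<forall>b\<ge>0. l 0 b = 0))"

definition sandwich_property ::
  "real \<Rightarrow> real \<Rightarrow> (nat pmf \<Rightarrow> nat pmf \<Rightarrow> ennreal) \<Rightarrow> bool" where
  "sandwich_property \<kappa>1 \<kappa>2 d \<longleftrightarrow>
    (\<forall>q1 q2. ennreal \<kappa>1 * hellinger_sq q1 q2 \<le> d q1 q2 \<and>
             d q1 q2 \<le> ennreal \<kappa>2 * chi_sq q1 q2)"

text \<open>
  The pushforward of the uniform distribution on the indices \<open>1, \<dots>, n\<close> under the sample.
\<close>

definition empirical_pmf :: "nat \<Rightarrow> (nat \<Rightarrow> nat) \<Rightarrow> nat pmf" where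
  "empirical_pmf n Y = map_pmf Y (pmf_of_set {1..n})"

definition min_distance_estimator ::
  "(nat pmf \<Rightarrow> nat pmf \<Rightarrow> ennreal) \<Rightarrow> nat pmf \<Rightarrow> real measure" where
  "min_distance_estimator d p =
    arg_min_on (\<lambda>Q. d p (poisson_mixture Q)) (prob_measures_on {0..})"

text \<open>
  The expected loss over an i.i.d. sample of size \<open>n\<close> from the mixture: the sample is drawn from
  the product distribution on functions (the value \<open>0\<close> outside \<open>{1..n}\<close> is a dummy).  The
  distribution is discrete, so every function of the sample is measurable.
\<close>

definition hellinger_risk ::
  "(nat pmf \<Rightarrow> nat pmf \<Rightarrow> ennreal) \<Rightarrow> nat \<Rightarrow> real measure \<Rightarrow> ennreal" where
  "hellinger_risk d n G =
    (\<integral>\<^sup>+ Y. hellinger_sq (poisson_mixture G)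
               (poisson_mixture (min_distance_estimator d (empirical_pmf n Y)))
       \<partial>measure_pmf (Pi_pmf {1..n} 0 (\<lambda>_. poisson_mixture G)))"

lemma pmf_poisson_mixture:
  assumes "G \<in> prob_measures_on {0..}"
  shows "pmf (poisson_mixture G) y = (LINT \<theta>|G. exp (- \<theta>) * \<theta> ^ y / fact y)"
proof -
  define g :: "nat \<Rightarrow> real \<Rightarrow> real" where "g = (\<lambda>y \<theta>. exp (- \<theta>) * \<theta> ^ y / fact y)"
  interpret real_distribution G using assms by (simp add: prob_measures_on_def)
  have [measurable]: "g y \<in> borel_measurable G" for y
    unfolding g_def by measurable
  have "prob {0..} = 1" using assms by (simp add: prob_measures_on_def)
  then have ae: "AE \<theta> in G. 0 \<le> \<theta>"
    using prob_eq_1[of "{0..}"] by auto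
  have nonneg: "0 \<le> g y \<theta>" if "0 \<le> \<theta>" for y \<theta>
    using that by (simp add: g_def)
  have sums: "(\<lambda>y. g y \<theta>) sums 1" for \<theta>
  proof -
    have "(\<lambda>y. exp (- \<theta>) * (\<theta> ^ y /\<^sub>R fact y)) sums (exp (- \<theta>) * exp \<theta>)"
      by (intro sums_mult exp_converges)
    then show ?thesis by (simp add: g_def divide_inverse mult_ac flip: exp_add)
  qed
  have le1: "g y \<theta> \<le> 1" if "0 \<le> \<theta>" for y \<theta>
    using sum_le_suminf[of "\<lambda>y. g y \<theta>" "{y}"] sums[of \<theta>] nonneg[OF that]
    by (simp add: sums_iff)
  have g01: "AE \<theta> in G. 0 \<le> g y \<theta> \<and> g y \<theta> \<le> 1" for y
    using ae by eventually_elim (simp add: nonneg le1)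
  have int: "integrable G (g y)" for y
    by (rule integrable_const_bound[where B = 1]) (use g01[of y] in auto)
  have eq: "ennreal (LINT \<theta>|G. g y \<theta>) = (\<integral>\<^sup>+ \<theta>. ennreal (g y \<theta>) \<partial>G)" for y
    by (rule nn_integral_eq_integral[symmetric]) (use int g01[of y] in auto)
  have "(\<Sum>y. ennreal (LINT \<theta>|G. g y \<theta>)) = (\<integral>\<^sup>+ \<theta>. (\<Sum>y. ennreal (g y \<theta>)) \<partial>G)"
    unfolding eq by (rule nn_integral_suminf[symmetric]) measurable
  also have "\<dots> = (\<integral>\<^sup>+ \<theta>. 1 \<partial>G)"
  proof (rule nn_integral_cong_AE, use ae in eventually_elim)
    fix \<theta> :: real
    assume "0 \<le> \<theta>"
    then show "(\<Sum>y. ennreal (g y \<theta>)) = 1"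
      using suminf_ennreal_eq[OF nonneg sums] by simp
  qed
  also have "\<dots> = 1" using emeasure_space_1 by simp
  finally have "(\<integral>\<^sup>+ y. ennreal (LINT \<theta>|G. g y \<theta>) \<partial>count_space UNIV) = 1"
    by (simp add: nn_integral_count_space_nat)
  moreover have "0 \<le> (LINT \<theta>|G. g y \<theta>)" for y
    by (rule integral_nonneg_AE) (use g01[of y] in auto)
  ultimately show ?thesis
    unfolding poisson_mixture_def by (subst pmf_embed_pmf) (simp_all add: g_def)
qed

lemma pmf_empirical_pmf:
  assumes "n \<ge> 1"
  shows "pmf (empirical_pmf n Y) y = (\<Sum>i=1..n. if Y i = y then 1 else 0) / real n"
proof -
  have "{1..n} \<inter> Y -` {y} = {1..n} \<inter> {i. Y i = y}" by auto
  then show ?thesis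
    using assms by (simp add: empirical_pmf_def pmf_map measure_pmf_of_set sum.If_cases)
qed

end

theory Submission
  imports Defs
begin

text \<open>
  The two sandwich inequalities, the optimality of the estimator and
  \<open>(a - b)\<^sup>2 \<le> 2 (a - c)\<^sup>2 + 2 (c - b)\<^sup>2\<close> bound the loss by a constant times
  the chi-squared divergence of the empirical distribution from the true mixture.  That divergence
  has infinite mean in general, so the sample is truncated: if all observations are below \<open>K\<close>, it
  splits into \<open>K\<close> terms of mean at most \<open>1 / n\<close> and the tail mass \<open>\<epsilon>\<close> of the mixture
  beyond \<open>K\<close>; otherwise, an event of probability at most \<open>n \<epsilon>\<close>, the loss is at most
  \<open>2\<close>.  Chernoff's bound makes \<open>\<epsilon>\<close> of order \<open>1 / n\<^sup>2\<close> for \<open>K\<close> of the order of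
  the claimed rate times \<open>n\<close>.

  The estimator is a genuine minimizer because the empirical distribution has finite support, so
  that the objective involves only finitely many values of the mixture and decreases in each of them.
\<close>

section \<open>Tails of Poisson mixtures\<close>

definition poisson_weight :: "nat \<Rightarrow> real \<Rightarrow> real" where
  "poisson_weight y \<theta> = exp (- \<theta>) * \<theta> ^ y / fact y"

lemma poisson_weight_nonneg: "0 \<le> \<theta> \<Longrightarrow> 0 \<le> poisson_weight y \<theta>"
  by (simp add: poisson_weight_def)

text \<open>The probability generating function of the Poisson law, read off the exponential series
  at \<open>\<theta> * x\<close>. At \<open>x = 1\<close> it gives total mass one; for larger
  \<open>x\<close> it drives the Chernoff bound.\<close>

lemma sums_poisson_weight: "(\<lambda>y. x ^ y * poisson_weight y \<theta>) sums exp (\<theta> * (x - 1))"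
proof -
  have "(\<lambda>y. exp (- \<theta>) * ((\<theta> * x) ^ y /\<^sub>R fact y)) sums (exp (- \<theta>) * exp (\<theta> * x))"
    by (intro sums_mult exp_converges)
  also have "exp (- \<theta>) * exp (\<theta> * x) = exp (\<theta> * (x - 1))"
    by (simp add: algebra_simps flip: exp_add)
  also have "(\<lambda>y. exp (- \<theta>) * ((\<theta> * x) ^ y /\<^sub>R fact y)) = (\<lambda>y. x ^ y * poisson_weight y \<theta>)"
    by (simp add: poisson_weight_def divide_inverse power_mult_distrib mult_ac)
  finally show ?thesis .
qed

lemma sums_poisson_weight_1: "(\<lambda>y. poisson_weight y \<theta>) sums 1"
  using sums_poisson_weight[of 1 \<theta>] by simp

lemma poisson_weight_le_1: "0 \<le> \<theta> \<Longrightarrow> poisson_weight y \<theta> \<le> 1"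
  using sum_le_suminf[of "\<lambda>y. poisson_weight y \<theta>" "{y}"] sums_poisson_weight_1[of \<theta>]
    poisson_weight_nonneg[of \<theta>]
  by (simp add: sums_iff)

lemma measurable_poisson_weight [measurable]: "poisson_weight y \<in> borel_measurable borel"
  unfolding poisson_weight_def by measurable

lemma AE_nonneg_prob_measures_on:
  assumes "G \<in> prob_measures_on {0..}"
  shows "AE \<theta> in G. 0 \<le> \<theta>"
proof -
  interpret real_distribution G using assms by (simp add: prob_measures_on_def)
  show ?thesis
    using assms prob_eq_1[of "{0..}"] by (auto simp: prob_measures_on_def)
qed

lemma integrable_poisson_weight:
  assumes "G \<in> prob_measures_on {0..}"
  shows "integrable G (poisson_weight y)"
proof -
  interpret real_distribution G using assms by (simp add: prob_measures_on_def)
  show ?thesis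
    by (rule integrable_const_bound[where B = 1])
      (use AE_nonneg_prob_measures_on[OF assms] in
        \<open>auto simp: poisson_weight_nonneg poisson_weight_le_1 elim!: eventually_mono\<close>)
qed

lemma pmf_poisson_mixture_weight:
  "G \<in> prob_measures_on {0..} \<Longrightarrow> pmf (poisson_mixture G) y = (LINT \<theta>|G. poisson_weight y \<theta>)"
  by (simp add: pmf_poisson_mixture poisson_weight_def)

lemma emeasure_pmf_nat:
  fixes p :: "nat pmf"
  shows "emeasure (measure_pmf p) A = (\<Sum>y. ennreal (pmf p y) * indicator A y)"
  using nn_integral_pmf[of A p, symmetric]
  by (simp add: nn_integral_count_space_indicator nn_integral_count_space_nat)

lemma suminf_pmf_nat: "(\<Sum>y::nat. ennreal (pmf p y)) = 1"
  using emeasure_pmf_nat[of p UNIV] by simp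

text \<open>The mixing measure is split at \<open>a\<close>. Parameters above \<open>a\<close>
  contribute at most their mass; for the others, Markov's inequality for \<open>x ^ y\<close> gives
  Chernoff's bound, which grows with the parameter because \<open>1 \<le> x\<close> and so is
  largest at \<open>a\<close>.\<close>

lemma measure_poisson_mixture_tail:
  assumes G: "G \<in> prob_measures_on {0..}" and x: "1 \<le> x"
  shows "measure (measure_pmf (poisson_mixture G)) {K..} \<le> measure G {a<..} + exp (a * (x - 1)) / x ^ K"
proof -
  interpret real_distribution G using G by (simp add: prob_measures_on_def)
  note ae = AE_nonneg_prob_measures_on[OF G]
  define b where "b = exp (a * (x - 1)) / x ^ K"
  have b: "0 \<le> b" using x by (simp add: b_def)
  have eq: "ennreal (pmf (poisson_mixture G) y) = (\<integral>\<^sup>+ \<theta>. ennreal (poisson_weight y \<theta>) \<partial>G)" for y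
    unfolding pmf_poisson_mixture_weight[OF G]
    by (rule nn_integral_eq_integral[symmetric, OF integrable_poisson_weight[OF G]])
      (use ae in \<open>auto simp: poisson_weight_nonneg elim!: eventually_mono\<close>)
  have pointwise: "(\<Sum>y. ennreal (poisson_weight y \<theta>) * indicator {K..} y)
      \<le> indicator {a<..} \<theta> + ennreal b" (is "?L \<le> _") if \<theta>: "0 \<le> \<theta>" for \<theta>
  proof (cases "a < \<theta>")
    case True
    have "?L \<le> (\<Sum>y. ennreal (poisson_weight y \<theta>))"
      by (intro suminf_le summableI) (auto split: split_indicator)
    also have "\<dots> = 1"
      using suminf_ennreal_eq[OF poisson_weight_nonneg[OF \<theta>] sums_poisson_weight_1] by simp
    finally show ?thesis using True by (simp add: add_increasing2)
  next
    case False
    have "?L \<le> (\<Sum>y. ennreal (x ^ y * poisson_weight y \<theta> / x ^ K))"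
    proof (intro suminf_le summableI)
      fix y
      show "ennreal (poisson_weight y \<theta>) * indicator {K..} y \<le> ennreal (x ^ y * poisson_weight y \<theta> / x ^ K)"
      proof (cases "K \<le> y")
        case True
        then have "x ^ K * poisson_weight y \<theta> \<le> x ^ y * poisson_weight y \<theta>"
          using x \<theta> by (intro mult_right_mono power_increasing poisson_weight_nonneg)
        then show ?thesis
          using True x by (auto simp: field_simps intro!: ennreal_leI)
      qed simp
    qed
    also have "\<dots> = ennreal (exp (\<theta> * (x - 1)) / x ^ K)"
      by (rule suminf_ennreal_eq) (use x \<theta> poisson_weight_nonneg in \<open>auto intro!: sums_divide sums_poisson_weight\<close>)
    also have "\<dots> \<le> ennreal b"
      unfolding b_def using x False by (intro ennreal_leI divide_right_mono) (auto intro!: mult_right_mono)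
    finally show ?thesis using False by simp
  qed
  have "emeasure (measure_pmf (poisson_mixture G)) {K..}
      = (\<Sum>y. (\<integral>\<^sup>+ \<theta>. ennreal (poisson_weight y \<theta>) * indicator {K..} y \<partial>G))"
    by (simp add: emeasure_pmf_nat eq nn_integral_multc)
  also have "\<dots> = (\<integral>\<^sup>+ \<theta>. (\<Sum>y. ennreal (poisson_weight y \<theta>) * indicator {K..} y) \<partial>G)"
    by (rule nn_integral_suminf[symmetric]) measurable
  also have "\<dots> \<le> (\<integral>\<^sup>+ \<theta>. indicator {a<..} \<theta> + ennreal b \<partial>G)"
    by (rule nn_integral_mono_AE) (use ae pointwise in \<open>auto elim!: eventually_mono\<close>)
  also have "\<dots> = ennreal (measure G {a<..} + b)"
    using b by (subst nn_integral_add) (auto simp: emeasure_eq_measure prob_space[simplified])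
  finally show ?thesis
    using b by (simp add: measure_pmf.emeasure_eq_measure b_def del: ennreal_plus)
qed

section \<open>Hellinger distance\<close>

text \<open>Dropping the cross term leaves two total masses. This crude bound serves on the rare
  event that some observation reaches the truncation level.\<close>

lemma hellinger_sq_le_2: "hellinger_sq p q \<le> 2"
proof -
  have "(sqrt a - sqrt b)\<^sup>2 \<le> a + b" if "0 \<le> a" "0 \<le> b" for a b :: real
    using that by (simp add: power2_diff)
  then have "hellinger_sq p q \<le> (\<Sum>y. ennreal (pmf p y) + ennreal (pmf q y))"
    unfolding hellinger_sq_def
    by (intro suminf_le summableI) (auto simp flip: ennreal_plus intro!: ennreal_leI)
  also have "\<dots> = 2" by (simp flip: suminf_add add: suminf_pmf_nat)
  finally show ?thesis .
qed

lemma hellinger_sq_triangle: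
  "hellinger_sq p q \<le> 2 * (hellinger_sq r p + hellinger_sq r q)"
proof -
  \<comment> \<open>The two sides differ by exactly \<open>(a + b - 2 * c)\<^sup>2\<close>.\<close>
  have *: "(a - b)\<^sup>2 \<le> 2 * ((c - a)\<^sup>2 + (c - b)\<^sup>2)" for a b c :: real
    using zero_le_power2[of "a + b - 2 * c"] by (simp add: power2_eq_square algebra_simps)
  have "hellinger_sq p q \<le> (\<Sum>y. 2 * (ennreal ((sqrt (pmf r y) - sqrt (pmf p y))\<^sup>2)
      + ennreal ((sqrt (pmf r y) - sqrt (pmf q y))\<^sup>2)))"
    unfolding hellinger_sq_def
  proof (intro suminf_le summableI)
    fix y
    show "ennreal ((sqrt (pmf p y) - sqrt (pmf q y))\<^sup>2)
      \<le> 2 * (ennreal ((sqrt (pmf r y) - sqrt (pmf p y))\<^sup>2) + ennreal ((sqrt (pmf r y) - sqrt (pmf q y))\<^sup>2))"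
      using ennreal_leI[OF *[of "sqrt (pmf p y)" "sqrt (pmf q y)" "sqrt (pmf r y)"]]
      by (simp add: ennreal_mult)
  qed
  also have "\<dots> = 2 * (hellinger_sq r p + hellinger_sq r q)"
    unfolding hellinger_sq_def ennreal_suminf_cmult by (simp flip: suminf_add)
  finally show ?thesis .
qed

section \<open>Mean squared error of the empirical distribution\<close>

text \<open>Independence and zero mean annihilate the off-diagonal products, so only the diagonal
  survives; the bound on \<open>g\<close> supplies integrability.\<close>

lemma expectation_square_sum_Pi_pmf:
  fixes g :: "'b \<Rightarrow> real"
  assumes A: "finite A" and bound: "\<And>x. \<bar>g x\<bar> \<le> B" and mean: "measure_pmf.expectation p g = 0"
  shows "measure_pmf.expectation (Pi_pmf A dflt (\<lambda>_. p)) (\<lambda>Y. (\<Sum>i\<in>A. g (Y i))\<^sup>2)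
    = card A * measure_pmf.expectation p (\<lambda>x. (g x)\<^sup>2)"
proof -
  let ?P = "Pi_pmf A dflt (\<lambda>_. p)"
  have comp: "measure_pmf.expectation ?P (\<lambda>Y. f (Y i)) = measure_pmf.expectation p f"
    if "i \<in> A" for i and f :: "'b \<Rightarrow> real"
    using that integral_map_pmf[of "\<lambda>Y. Y i" ?P f] Pi_pmf_component[OF A, of i dflt "\<lambda>_. p"] by simp
  have int: "integrable (measure_pmf ?P) (\<lambda>Y. g (Y i))" for i
    by (rule measure_pmf.integrable_const_bound[where B = B]) (use bound in auto)
  have int2: "integrable (measure_pmf ?P) (\<lambda>Y. g (Y i) * g (Y j))" for i j
    by (rule measure_pmf.integrable_const_bound[where B = "B * B"])
      (use bound order_trans[OF abs_ge_zero bound] in \<open>auto simp: abs_mult intro!: mult_mono\<close>)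
  have indep: "prob_space.indep_vars ?P (\<lambda>_. borel) (\<lambda>i Y. g (Y i)) A"
    using prob_space.indep_vars_compose2[OF measure_pmf.prob_space_axioms
        indep_vars_Pi_pmf[OF A], of "\<lambda>_. g" "\<lambda>_. borel"] by simp
  have cross: "measure_pmf.expectation ?P (\<lambda>Y. g (Y i) * g (Y j)) = 0"
    if "i \<in> A" "j \<in> A" "i \<noteq> j" for i j
    using prob_space.indep_vars_lebesgue_integral[OF measure_pmf.prob_space_axioms _
        prob_space.indep_vars_subset[OF measure_pmf.prob_space_axioms indep] int, of "{i, j}"]
      comp[OF that(1), of g] mean that by simp
  have "measure_pmf.expectation ?P (\<lambda>Y. (\<Sum>i\<in>A. g (Y i))\<^sup>2)
    = (\<Sum>i\<in>A. \<Sum>j\<in>A. measure_pmf.expectation ?P (\<lambda>Y. g (Y i) * g (Y j)))"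
    by (simp add: power2_eq_square sum_product int2)
  also have "\<dots> = (\<Sum>i\<in>A. measure_pmf.expectation ?P (\<lambda>Y. g (Y i) * g (Y i)))"
  proof (rule sum.cong[OF refl])
    fix i assume "i \<in> A"
    then show "(\<Sum>j\<in>A. measure_pmf.expectation ?P (\<lambda>Y. g (Y i) * g (Y j)))
      = measure_pmf.expectation ?P (\<lambda>Y. g (Y i) * g (Y i))"
      using A cross[OF \<open>i \<in> A\<close>] by (subst sum.remove[of A i]) (auto intro!: sum.neutral)
  qed
  also have "\<dots> = card A * measure_pmf.expectation p (\<lambda>x. (g x)\<^sup>2)"
    using comp[of _ "\<lambda>x. g x * g x"] by (simp add: power2_eq_square)
  finally show ?thesis .
qed

text \<open>An empirical frequency averages \<open>n\<close> independent indicators, and a Bernoulli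
  variance is at most the success probability. Keeping the factor \<open>pmf p y\<close> matters: it
  cancels against the denominator of the chi-squared term.\<close>

lemma nn_integral_empirical_pmf_error:
  fixes n :: nat
  assumes n: "1 \<le> n"
  shows "(\<integral>\<^sup>+ Y. ennreal ((pmf (empirical_pmf n Y) y - pmf p y)\<^sup>2) \<partial>measure_pmf (Pi_pmf {1..n} 0 (\<lambda>_. p)))
    \<le> ennreal (pmf p y / n)"
proof -
  let ?P = "Pi_pmf {1..n} 0 (\<lambda>_. p)"
  define g where "g z = indicator {y} z - pmf p y" for z
  have [simp]: "measure_pmf.expectation p (indicator {y}) = pmf p y"
    by (simp add: measure_pmf_single)
  have bound: "\<bar>g z\<bar> \<le> 1" for z
    using pmf_le_1[of p y] by (auto simp: g_def indicator_def)
  have int: "integrable (measure_pmf p) (indicator {y} :: nat \<Rightarrow> real)"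
    by (rule measure_pmf.integrable_const_bound[where B = 1]) auto
  have mean: "measure_pmf.expectation p g = 0"
    by (simp add: g_def[abs_def] int measure_pmf_single)
  have "(g z)\<^sup>2 = indicator {y} z - 2 * pmf p y * indicator {y} z + (pmf p y)\<^sup>2" for z
    by (simp add: g_def power2_eq_square algebra_simps split: split_indicator)
  then have "measure_pmf.expectation p (\<lambda>z. (g z)\<^sup>2) = pmf p y - (pmf p y)\<^sup>2"
    by (simp add: int power2_eq_square measure_pmf_single)
  then have var: "measure_pmf.expectation p (\<lambda>z. (g z)\<^sup>2) \<le> pmf p y" by simp
  have eq: "pmf (empirical_pmf n Y) y - pmf p y = (\<Sum>i\<in>{1..n}. g (Y i)) / n" for Y
    using n by (simp add: pmf_empirical_pmf g_def sum_subtractf diff_divide_distrib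
        indicator_def sum.If_cases Int_def vimage_def)
  have "\<bar>\<Sum>i\<in>{1..n}. g (Y i)\<bar> \<le> n" for Y
    using order_trans[OF sum_abs sum_bounded_above[of "{1..n}" "\<lambda>i. \<bar>g (Y i)\<bar>" 1]] bound by simp
  then have sq: "(\<Sum>i\<in>{1..n}. g (Y i))\<^sup>2 \<le> (real n)\<^sup>2" for Y
    by (metis abs_ge_zero power_mono power2_abs)
  have "integrable (measure_pmf ?P) (\<lambda>Y. (\<Sum>i\<in>{1..n}. g (Y i))\<^sup>2)"
    by (rule measure_pmf.integrable_const_bound[where B = "(real n)\<^sup>2"]) (use sq in auto)
  then have "(\<integral>\<^sup>+ Y. ennreal ((pmf (empirical_pmf n Y) y - pmf p y)\<^sup>2) \<partial>measure_pmf ?P)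
    = ennreal (measure_pmf.expectation ?P (\<lambda>Y. (\<Sum>i\<in>{1..n}. g (Y i))\<^sup>2 / (real n)\<^sup>2))"
    unfolding eq power_divide by (intro nn_integral_eq_integral) auto
  also have "\<dots> = ennreal (measure_pmf.expectation p (\<lambda>z. (g z)\<^sup>2) / n)"
    using n expectation_square_sum_Pi_pmf[OF _ bound mean, of "{1..n}" 0]
    by (simp add: power2_eq_square)
  also have "\<dots> \<le> ennreal (pmf p y / n)"
    using var by (intro ennreal_leI divide_right_mono) auto
  finally show ?thesis .
qed

section \<open>Existence of the minimum-distance estimator\<close>

text \<open>Weak convergence is tested against functions on the whole line, while the compactified
  mixing measures live on the unit interval; composing with this projection extends the weights
  continuously.\<close>

definition clip :: "real \<Rightarrow> real" where
  "clip u = max 0 (min 1 u)"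

lemma clip_mem: "0 \<le> clip u" "clip u \<le> 1"
  by (auto simp: clip_def)

lemma measurable_clip [measurable]: "clip \<in> borel_measurable borel"
  unfolding clip_def by measurable

text \<open>The Poisson weight in the variable \<open>u = exp (- \<theta>)\<close>. At
  \<open>u = 0\<close>, which stands for infinite \<open>\<theta>\<close>, the leading factor makes
  it vanish, also for \<open>y = 0\<close>; this is the continuous extension.\<close>

definition compact_weight :: "nat \<Rightarrow> real \<Rightarrow> real" where
  "compact_weight y u = clip u * (- ln (clip u)) ^ y / fact y"

lemma compact_weight_eq: "0 < clip u \<Longrightarrow> compact_weight y u = poisson_weight y (- ln (clip u))"
  by (simp add: compact_weight_def poisson_weight_def)

lemma neg_ln_clip_nonneg: "0 \<le> - ln (clip u)"
  using clip_mem[of u] by (cases "clip u = 0") auto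

text \<open>Equality holds unless \<open>clip u = 0\<close>. There the left side is zero, while
  \<open>ln 0 = 0\<close> turns the right side into the weight at parameter
  \<open>0\<close>.\<close>

lemma compact_weight_le: "compact_weight y u \<le> poisson_weight y (- ln (clip u))"
proof (cases "clip u = 0")
  case True
  then show ?thesis
    using poisson_weight_nonneg[OF neg_ln_clip_nonneg, of y u] by (simp add: compact_weight_def)
qed (use clip_mem[of u] compact_weight_eq[of u y] in auto)

lemma compact_weight_bound: "\<bar>compact_weight y u\<bar> \<le> 1"
proof -
  have "0 \<le> compact_weight y u"
    unfolding compact_weight_def using clip_mem[of u] neg_ln_clip_nonneg[of u] by simp
  moreover have "compact_weight y u \<le> 1"
    using compact_weight_le[of y u] poisson_weight_le_1[OF neg_ln_clip_nonneg, of y u] by linarith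
  ultimately show ?thesis by simp
qed

text \<open>Only the endpoint \<open>0\<close> is delicate: with \<open>t = - ln v\<close> the
  function becomes \<open>t ^ y / exp t / fact y\<close>, which tends to \<open>0\<close> as
  \<open>t\<close> grows. One-sided continuity there suffices because \<open>clip\<close> takes no
  negative values.\<close>

lemma isCont_compact_weight: "isCont (compact_weight y) u"
proof -
  let ?g = "\<lambda>v::real. v * (- ln v) ^ y / fact y"
  have "((\<lambda>t::real. t ^ y / exp t / fact y) \<longlongrightarrow> 0) at_top"
    using tendsto_divide[OF tendsto_power_div_exp_0 tendsto_const, of "fact y :: real" y] by simp
  moreover have "filterlim (\<lambda>v. - ln v :: real) at_top (at_right 0)"
    using ln_at_0 by (simp add: filterlim_uminus_at_top)
  ultimately have "((\<lambda>v. (- ln v) ^ y / exp (- ln v) / fact y) \<longlongrightarrow> 0) (at_right (0::real))"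
    by (rule filterlim_compose)
  then have lim: "(?g \<longlongrightarrow> 0) (at_right 0)"
  proof (rule Lim_transform_eventually)
    show "\<forall>\<^sub>F v in at_right 0. (- ln v) ^ y / exp (- ln v) / fact y = ?g v"
      using eventually_at_right_less[of "0::real"]
      by eventually_elim (simp add: exp_minus field_simps)
  qed
  have "continuous_on {0..} ?g"
    unfolding continuous_on_def
  proof
    fix v :: real assume v: "v \<in> {0..}"
    show "(?g \<longlongrightarrow> ?g v) (at v within {0..})"
    proof (cases "v = 0")
      case True
      then show ?thesis using lim by (simp add: at_within_Ici_at_right)
    next
      case False
      then have "isCont ?g v" using v by (auto intro!: continuous_intros)
      then show ?thesis using isContD tendsto_within_subset by blast
    qed
  qed
  then have "continuous_on UNIV (\<lambda>u. ?g (clip u))"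
    by (rule continuous_on_compose2) (auto simp: clip_def intro!: continuous_intros)
  then show ?thesis
    by (simp add: compact_weight_def[abs_def] continuous_on_eq_continuous_at)
qed

text \<open>
  The map \<open>\<theta> \<mapsto> exp (- \<theta>)\<close> compactifies the half-line to the unit interval.  Mass that escapes
  to infinity ends up at the point \<open>0\<close>, where the weights vanish; pulling back with
  \<open>u \<mapsto> - ln u\<close> moves it to \<open>\<theta> = 0\<close>, because \<open>ln 0 = 0\<close>, and this
  only increases the mixture.
\<close>

lemma poisson_mixture_subsequence_limit:
  assumes Q: "\<And>k. Q k \<in> prob_measures_on {0..}"
  shows "\<exists>r Q' b. strict_mono (r :: nat \<Rightarrow> nat) \<and> Q' \<in> prob_measures_on {0..} \<and>
    (\<forall>y. (\<lambda>k. pmf (poisson_mixture (Q (r k))) y) \<longlonglongrightarrow> b y \<and> b y \<le> pmf (poisson_mixture Q') y)"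
proof -
  interpret Q: real_distribution "Q k" for k using Q by (simp add: prob_measures_on_def)
  define \<mu> where "\<mu> k = distr (Q k) borel (\<lambda>\<theta>. exp (- \<theta>))" for k
  interpret \<mu>: real_distribution "\<mu> k" for k
    unfolding \<mu>_def by (rule Q.real_distribution_distr) simp
  have "measure (\<mu> k) {-1<..1} = 1" for k
  proof -
    have "(\<lambda>\<theta>. exp (- \<theta>)) -` {-1<..1} \<inter> space (Q k) = {0..}"
      using order_less_trans[OF _ exp_gt_zero, of "-1::real"] by auto
    then show ?thesis
      unfolding \<mu>_def using Q[of k] by (subst measure_distr) (auto simp: prob_measures_on_def)
  qed
  \<comment> \<open>All mass lies in one bounded interval, which therefore serves every
    tolerance.\<close>
  then have "tight \<mu>"
    unfolding tight_def using \<mu>.real_distribution_axioms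
    by (intro conjI allI impI exI[of _ "-1::real"] exI[of _ "1::real"]) auto
  from tight_imp_convergent_subsubsequence[OF this strict_mono_id]
  obtain r M where r: "strict_mono r" and M: "real_distribution M"
    and conv: "weak_conv_m (\<mu> \<circ> r) M" by auto
  interpret M: real_distribution M by fact
  define Q' where "Q' = distr M borel (\<lambda>u. - ln (clip u))"
  interpret Q': real_distribution Q'
    unfolding Q'_def by (rule M.real_distribution_distr) simp
  have "(\<lambda>u. - ln (clip u)) -` {0..} \<inter> space M = UNIV"
    using neg_ln_clip_nonneg by auto
  then have Q': "Q' \<in> prob_measures_on {0..}"
    unfolding prob_measures_on_def using Q'.real_distribution_axioms M.prob_space
    by (auto simp: Q'_def measure_distr)
  have mix: "pmf (poisson_mixture (Q k)) y = (LINT u|\<mu> k. compact_weight y u)" for k y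
  proof -
    have [measurable]: "compact_weight y \<in> borel_measurable borel"
      unfolding compact_weight_def by measurable
    have "(LINT u|\<mu> k. compact_weight y u) = (LINT \<theta>|Q k. compact_weight y (exp (- \<theta>)))"
      unfolding \<mu>_def by (rule integral_distr) auto
    also have "\<dots> = (LINT \<theta>|Q k. poisson_weight y \<theta>)"
    proof (rule integral_cong_AE)
      show "AE \<theta> in Q k. compact_weight y (exp (- \<theta>)) = poisson_weight y \<theta>"
        using AE_nonneg_prob_measures_on[OF Q[of k]]
        by eventually_elim (subst compact_weight_eq; simp add: clip_def min_def)
    qed auto
    finally show ?thesis by (simp add: pmf_poisson_mixture_weight[OF Q])
  qed
  \<comment> \<open>Each weight is bounded and continuous in \<open>u\<close>, hence an admissible
    test function for weak convergence.\<close>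
  have lim: "(\<lambda>k. pmf (poisson_mixture (Q (r k))) y) \<longlonglongrightarrow> (LINT u|M. compact_weight y u)" for y
    using weak_conv_imp_integral_bdd_continuous_conv[OF _ M conv, of "compact_weight y" 1]
      isCont_compact_weight compact_weight_bound \<mu>.real_distribution_axioms
    by (simp add: mix)
  have le: "(LINT u|M. compact_weight y u) \<le> pmf (poisson_mixture Q') y" for y
  proof -
    have [measurable]: "compact_weight y \<in> borel_measurable borel"
      unfolding compact_weight_def by measurable
    have "(LINT u|M. compact_weight y u) \<le> (LINT u|M. poisson_weight y (- ln (clip u)))"
    proof (rule integral_mono)
      show "integrable M (compact_weight y)"
        by (rule M.integrable_const_bound[where B = 1]) (auto simp: compact_weight_bound)
      show "integrable M (\<lambda>u. poisson_weight y (- ln (clip u)))"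
        by (rule M.integrable_const_bound[where B = 1])
          (auto simp: poisson_weight_nonneg[OF neg_ln_clip_nonneg] poisson_weight_le_1[OF neg_ln_clip_nonneg])
    qed (rule compact_weight_le)
    also have "\<dots> = (LINT \<theta>|Q'. poisson_weight y \<theta>)"
      unfolding Q'_def by (rule integral_distr[symmetric]) auto
    finally show ?thesis by (simp add: pmf_poisson_mixture_weight[OF Q'])
  qed
  show ?thesis
    using r Q' lim le
    by (intro exI[of _ r] exI[of _ Q'] exI[of _ "\<lambda>y. LINT u|M. compact_weight y u"]) auto
qed

text \<open>Extended addition is discontinuous only where opposite infinities meet, and this cannot
  happen when no limit is \<open>-\<infinity>\<close>.\<close>

lemma tendsto_sum_ereal_not_MInf:
  fixes f :: "'a \<Rightarrow> 'b \<Rightarrow> ereal"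
  assumes "finite A" "\<And>i. i \<in> A \<Longrightarrow> (f i \<longlongrightarrow> l i) F" "\<And>i. i \<in> A \<Longrightarrow> l i \<noteq> -\<infinity>"
  shows "((\<lambda>x. \<Sum>i\<in>A. f i x) \<longlongrightarrow> (\<Sum>i\<in>A. l i)) F"
  using assms
proof (induction rule: finite_induct)
  case (insert a A)
  have "(\<Sum>i\<in>A. l i) \<noteq> -\<infinity>"
    using insert.hyps(1) insert.prems(2) by (induction rule: finite_induct) auto
  then show ?case
    using insert by (auto intro!: tendsto_add_ereal_general)
qed simp

text \<open>Along a subsequence of a minimizing sequence the mixtures converge pointwise to some
  \<open>b\<close>, which may have lost mass. Continuity of \<open>l\<close> identifies the infimum
  with the objective at \<open>b\<close>; the mixture of \<open>Q'\<close> dominates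
  \<open>b\<close>, so by monotonicity of \<open>l\<close> its objective is no larger.\<close>

lemma min_distance_attained:
  assumes d: "decomposition_property d" and fin: "finite (set_pmf p)"
  shows "\<exists>Q\<in>prob_measures_on {0..}. \<forall>Q'\<in>prob_measures_on {0..}.
    d p (poisson_mixture Q) \<le> d p (poisson_mixture Q')"
proof -
  let ?S = "set_pmf p" and ?\<P> = "prob_measures_on {0..}"
  from d obtain t l where *: "\<forall>a\<ge>0. \<forall>b\<ge>0. l a b \<noteq> -\<infinity>"
      "\<forall>q1 q2. \<exists>S. (\<lambda>y. l (pmf q1 y) (pmf q2 y)) sums S \<and> enn2ereal (d q1 q2) = ereal (t q1) + S"
      "\<forall>a>0. strict_antimono_on {0..} (l a)"
      "\<forall>a>0. continuous_on {0..} (l a)"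
      "\<forall>b\<ge>0. l 0 b = 0"
    unfolding decomposition_property_def by (elim exE conjE) (rule that; assumption)
  then have notMInf: "\<And>a b. 0 \<le> a \<Longrightarrow> 0 \<le> b \<Longrightarrow> l a b \<noteq> -\<infinity>"
    and dec: "\<And>q1 q2. \<exists>S. (\<lambda>y. l (pmf q1 y) (pmf q2 y)) sums S \<and> enn2ereal (d q1 q2) = ereal (t q1) + S"
    and anti: "\<And>a. 0 < a \<Longrightarrow> strict_antimono_on {0..} (l a)"
    and cont: "\<And>a. 0 < a \<Longrightarrow> continuous_on {0..} (l a)"
    and zero: "\<And>b. 0 \<le> b \<Longrightarrow> l 0 b = 0"
    by blast+
  \<comment> \<open>Outside the support of \<open>p\<close> the terms are \<open>l 0 b = 0\<close>,
    so the series becomes a finite sum and limits can be taken term by term.\<close>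
  have d_eq: "enn2ereal (d p q) = ereal (t p) + (\<Sum>y\<in>?S. l (pmf p y) (pmf q y))" for q
  proof -
    obtain S where S: "(\<lambda>y. l (pmf p y) (pmf q y)) sums S" "enn2ereal (d p q) = ereal (t p) + S"
      using dec by blast
    have "(\<lambda>y. l (pmf p y) (pmf q y)) sums (\<Sum>y\<in>?S. l (pmf p y) (pmf q y))"
      by (rule sums_finite[OF fin]) (simp add: set_pmf_iff zero)
    with S show ?thesis using sums_unique2 by blast
  qed
  \<comment> \<open>A point mass witnesses that the class is nonempty, so the infimum is a limit of
    attained values.\<close>
  have "return borel 0 \<in> ?\<P>"
    by (auto simp: prob_measures_on_def measure_return prob_space_return
        real_distribution_def real_distribution_axioms_def)
  then obtain u where u: "\<And>k. u k \<in> (\<lambda>Q. d p (poisson_mixture Q)) ` ?\<P>"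
    and u_lim: "u \<longlonglongrightarrow> Inf ((\<lambda>Q. d p (poisson_mixture Q)) ` ?\<P>)"
    using Inf_as_limit[of "(\<lambda>Q. d p (poisson_mixture Q)) ` ?\<P>"] by blast
  from u have "\<forall>k. \<exists>Q. Q \<in> ?\<P> \<and> u k = d p (poisson_mixture Q)" by blast
  then obtain Q where Q: "\<And>k. Q k \<in> ?\<P>" "\<And>k. u k = d p (poisson_mixture (Q k))" by metis
  from poisson_mixture_subsequence_limit[of Q, OF Q(1)]
  obtain r Q' b where r: "strict_mono (r :: nat \<Rightarrow> nat)" and Q': "Q' \<in> ?\<P>"
    and lim: "\<And>y. (\<lambda>k. pmf (poisson_mixture (Q (r k))) y) \<longlonglongrightarrow> b y"
    and le: "\<And>y. b y \<le> pmf (poisson_mixture Q') y" by blast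
  have b: "0 \<le> b y" for y
    by (rule LIMSEQ_le_const[OF lim]) auto
  have pos: "0 < pmf p y" if "y \<in> ?S" for y
    using that by (simp add: pmf_positive_iff)
  \<comment> \<open>The limit \<open>b y\<close> may be \<open>0\<close>, where \<open>l\<close> may
    be infinite; this is why continuity on the closed half-line, in the extended reals, is
    used.\<close>
  have l_lim: "(\<lambda>k. l (pmf p y) (pmf (poisson_mixture (Q (r k))) y)) \<longlonglongrightarrow> l (pmf p y) (b y)"
    if "y \<in> ?S" for y
    by (rule continuous_on_tendsto_compose[OF cont[OF pos[OF that]] lim]) (use b in auto)
  have "(\<lambda>k. ereal (t p) + (\<Sum>y\<in>?S. l (pmf p y) (pmf (poisson_mixture (Q (r k))) y)))
      \<longlonglongrightarrow> ereal (t p) + (\<Sum>y\<in>?S. l (pmf p y) (b y))"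
    by (intro tendsto_add_ereal_general tendsto_sum_ereal_not_MInf tendsto_const fin l_lim)
      (use notMInf b in auto)
  then have "(\<lambda>k. enn2ereal (u (r k))) \<longlonglongrightarrow> ereal (t p) + (\<Sum>y\<in>?S. l (pmf p y) (b y))"
    by (simp add: Q(2) d_eq)
  moreover have "(\<lambda>k. enn2ereal (u (r k))) \<longlonglongrightarrow> enn2ereal (Inf ((\<lambda>Q. d p (poisson_mixture Q)) ` ?\<P>))"
    using continuous_on_tendsto_compose[OF continuous_on_enn2ereal LIMSEQ_subseq_LIMSEQ[OF u_lim r]]
    by (simp add: o_def)
  ultimately have "enn2ereal (Inf ((\<lambda>Q. d p (poisson_mixture Q)) ` ?\<P>))
      = ereal (t p) + (\<Sum>y\<in>?S. l (pmf p y) (b y))"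
    using LIMSEQ_unique by blast
  also have "\<dots> \<ge> enn2ereal (d p (poisson_mixture Q'))"
    unfolding d_eq
  proof (intro add_left_mono sum_mono)
    fix y assume y: "y \<in> ?S"
    show "l (pmf p y) (pmf (poisson_mixture Q') y) \<le> l (pmf p y) (b y)"
      using monotone_onD[OF anti[OF pos[OF y]], of "b y" "pmf (poisson_mixture Q') y"] b[of y] le[of y]
      by (cases "b y = pmf (poisson_mixture Q') y") auto
  qed
  finally have "d p (poisson_mixture Q') \<le> Inf ((\<lambda>Q. d p (poisson_mixture Q)) ` ?\<P>)"
    by (simp add: less_eq_ennreal.rep_eq)
  then show ?thesis using Q' by (meson INF_lower order_trans)
qed

lemma min_distance_estimator:
  assumes "decomposition_property d" and "finite (set_pmf p)"
  shows "min_distance_estimator d p \<in> prob_measures_on {0..}"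
    and "Q \<in> prob_measures_on {0..} \<Longrightarrow>
      d p (poisson_mixture (min_distance_estimator d p)) \<le> d p (poisson_mixture Q)"
proof -
  let ?f = "\<lambda>Q. d p (poisson_mixture Q)" and ?P = "\<lambda>Q. Q \<in> prob_measures_on {0..}"
  have "\<exists>Q. is_arg_min ?f ?P Q"
    using min_distance_attained[OF assms] by (auto simp: is_arg_min_def not_less)
  then have "is_arg_min ?f ?P (min_distance_estimator d p)"
    unfolding min_distance_estimator_def arg_min_on_def arg_min_def by (rule someI_ex)
  then show "min_distance_estimator d p \<in> prob_measures_on {0..}"
    and "Q \<in> prob_measures_on {0..} \<Longrightarrow>
      d p (poisson_mixture (min_distance_estimator d p)) \<le> d p (poisson_mixture Q)"
    by (auto simp: is_arg_min_def not_less)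
qed

section \<open>Risk bounds\<close>

lemma set_empirical_pmf: "1 \<le> n \<Longrightarrow> set_pmf (empirical_pmf n Y) = Y ` {1..n}"
  by (simp add: empirical_pmf_def)

text \<open>The relaxed triangle inequality through \<open>q\<close> gives a factor 2. Both
  resulting Hellinger terms are dominated by \<open>d q (poisson_mixture G)\<close>, the one for the
  estimator by optimality against \<open>G\<close>, which gives another 2.\<close>

lemma hellinger_sq_estimator_le:
  fixes \<kappa>1 \<kappa>2 :: real
  assumes d: "decomposition_property d" "sandwich_property \<kappa>1 \<kappa>2 d" and \<kappa>: "0 < \<kappa>1" "0 < \<kappa>2"
    and fin: "finite (set_pmf q)" and G: "G \<in> prob_measures_on {0..}"
  shows "hellinger_sq (poisson_mixture G) (poisson_mixture (min_distance_estimator d q))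
    \<le> ennreal (4 * \<kappa>2 / \<kappa>1) * chi_sq q (poisson_mixture G)"
proof -
  let ?f = "poisson_mixture G" and ?g = "poisson_mixture (min_distance_estimator d q)"
  have lower: "ennreal \<kappa>1 * hellinger_sq q1 q2 \<le> d q1 q2"
    and upper: "d q1 q2 \<le> ennreal \<kappa>2 * chi_sq q1 q2" for q1 q2
    using d(2) by (auto simp: sandwich_property_def)
  have opt: "d q ?g \<le> d q ?f"
    by (rule min_distance_estimator(2)[OF d(1) fin G])
  have "ennreal \<kappa>1 * hellinger_sq ?f ?g
      \<le> ennreal \<kappa>1 * (2 * (hellinger_sq q ?f + hellinger_sq q ?g))"
    by (intro mult_left_mono hellinger_sq_triangle) auto
  also have "\<dots> = 2 * (ennreal \<kappa>1 * hellinger_sq q ?f + ennreal \<kappa>1 * hellinger_sq q ?g)"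
    by (simp add: distrib_left mult_ac)
  also have "\<dots> \<le> 2 * (d q ?f + d q ?f)"
    using order_trans[OF lower opt] lower by (intro mult_left_mono add_mono) auto
  also have "\<dots> = 4 * d q ?f"
    by (simp flip: mult_2 add: mult.assoc[symmetric])
  also have "\<dots> \<le> 4 * (ennreal \<kappa>2 * chi_sq q ?f)"
    by (intro mult_left_mono upper) auto
  finally have "ennreal (1 / \<kappa>1) * (ennreal \<kappa>1 * hellinger_sq ?f ?g)
      \<le> ennreal (1 / \<kappa>1) * (4 * (ennreal \<kappa>2 * chi_sq q ?f))"
    by (intro mult_left_mono) auto
  moreover have "ennreal (1 / \<kappa>1) * (ennreal \<kappa>1 * hellinger_sq ?f ?g) = hellinger_sq ?f ?g"
    using \<kappa> by (simp flip: mult.assoc ennreal_mult)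
  moreover have "ennreal (1 / \<kappa>1) * (4 * (ennreal \<kappa>2 * chi_sq q ?f))
      = (ennreal (1 / \<kappa>1) * ennreal 4 * ennreal \<kappa>2) * chi_sq q ?f"
    by (simp add: mult_ac)
  moreover have "ennreal (1 / \<kappa>1) * ennreal 4 * ennreal \<kappa>2 = ennreal (4 * \<kappa>2 / \<kappa>1)"
    using \<kappa> by (simp del: ennreal_numeral flip: ennreal_mult)
  ultimately show ?thesis by simp
qed

text \<open>Where \<open>q\<close> vanishes, the chi-squared term is \<open>p\<^sup>2 / p\<close>,
  so beyond \<open>K\<close> the terms add up to at most the tail mass of \<open>p\<close>.\<close>

lemma chi_sq_le_truncated:
  assumes "\<And>y. K \<le> y \<Longrightarrow> pmf q y = 0"
  shows "chi_sq q p \<le> (\<Sum>y<K. ennreal ((pmf q y - pmf p y)\<^sup>2) / ennreal (pmf p y))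
    + emeasure (measure_pmf p) {K..}"
proof -
  let ?t = "\<lambda>y. ennreal ((pmf q y - pmf p y)\<^sup>2) / ennreal (pmf p y)"
  have "chi_sq q p \<le> (\<Sum>y. (if y < K then ?t y else 0) + ennreal (pmf p y) * indicator {K..} y)"
    unfolding chi_sq_def
  proof (intro suminf_le summableI)
    fix y
    show "?t y \<le> (if y < K then ?t y else 0) + ennreal (pmf p y) * indicator {K..} y"
    proof (cases "y < K")
      case False
      then have "?t y = ennreal ((pmf p y)\<^sup>2) / ennreal (pmf p y)" using assms[of y] by simp
      \<comment> \<open>If \<open>pmf p y = 0\<close>, the quotient is zero over zero, which is
        \<open>0\<close> in \<open>ennreal\<close>.\<close>
      also have "\<dots> \<le> ennreal (pmf p y)"
        by (cases "pmf p y = 0") (simp_all add: divide_ennreal power2_eq_square)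
      finally show ?thesis using False by simp
    qed simp
  qed
  also have "\<dots> = (\<Sum>y. if y < K then ?t y else 0) + emeasure (measure_pmf p) {K..}"
    by (simp add: emeasure_pmf_nat flip: suminf_add)
  also have "(\<Sum>y. if y < K then ?t y else 0) = (\<Sum>y<K. ?t y)"
    by (subst suminf_finite[of "{..<K}"]) auto
  finally show ?thesis .
qed

text \<open>The variance bound is proportional to the cell probability, so every cell costs at most
  \<open>1 / n\<close>, however rare it is.\<close>

lemma nn_integral_empirical_chi_term:
  fixes n :: nat
  assumes n: "1 \<le> n"
  shows "(\<integral>\<^sup>+ Y. ennreal ((pmf (empirical_pmf n Y) y - pmf p y)\<^sup>2) / ennreal (pmf p y)
      \<partial>measure_pmf (Pi_pmf {1..n} 0 (\<lambda>_. p))) \<le> ennreal (1 / n)"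
proof -
  let ?P = "Pi_pmf {1..n} 0 (\<lambda>_. p)"
  let ?I = "\<integral>\<^sup>+ Y. ennreal ((pmf (empirical_pmf n Y) y - pmf p y)\<^sup>2) \<partial>measure_pmf ?P"
  have le: "?I \<le> ennreal (pmf p y / n)"
    by (rule nn_integral_empirical_pmf_error[OF n])
  have "(\<integral>\<^sup>+ Y. ennreal ((pmf (empirical_pmf n Y) y - pmf p y)\<^sup>2) / ennreal (pmf p y)
      \<partial>measure_pmf ?P) = ?I / ennreal (pmf p y)"
    by (simp add: divide_ennreal_def nn_integral_multc)
  also have "\<dots> \<le> ennreal (pmf p y / n) / ennreal (pmf p y)"
    by (rule divide_right_mono_ennreal[OF le])
  also have "\<dots> \<le> ennreal (1 / n)"
    using n by (cases "pmf p y = 0") (simp_all add: divide_ennreal)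
  finally show ?thesis .
qed

lemma hellinger_risk_truncation:
  fixes \<kappa>1 \<kappa>2 :: real
  assumes d: "decomposition_property d" "sandwich_property \<kappa>1 \<kappa>2 d" and \<kappa>: "0 < \<kappa>1" "0 < \<kappa>2"
    and n: "1 \<le> n" and G: "G \<in> prob_measures_on {0..}"
    and tail: "measure (measure_pmf (poisson_mixture G)) {K..} \<le> \<epsilon>"
  shows "hellinger_risk d n G \<le> ennreal (4 * \<kappa>2 / \<kappa>1 * (K / n + \<epsilon>) + 2 * real n * \<epsilon>)"
proof -
  let ?p = "poisson_mixture G"
  let ?P = "Pi_pmf {1..n} 0 (\<lambda>_. ?p)"
  let ?C = "ennreal (4 * \<kappa>2 / \<kappa>1)"
  let ?t = "\<lambda>Y y. ennreal ((pmf (empirical_pmf n Y) y - pmf ?p y)\<^sup>2) / ennreal (pmf ?p y)"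
  let ?H = "\<lambda>Y. hellinger_sq ?p (poisson_mixture (min_distance_estimator d (empirical_pmf n Y)))"
  have \<epsilon>: "0 \<le> \<epsilon>" using tail measure_nonneg order_trans by blast
  have tail': "emeasure (measure_pmf ?p) {K..} \<le> ennreal \<epsilon>"
    using tail by (simp add: measure_pmf.emeasure_eq_measure ennreal_leI)
  \<comment> \<open>The sum of indicators is at least one as soon as some observation reaches
    \<open>K\<close>; adding it merges both cases into one bound that can be integrated without
    conditioning.\<close>
  have pointwise: "?H Y \<le> ?C * ((\<Sum>y<K. ?t Y y) + ennreal \<epsilon>) + 2 * (\<Sum>i\<in>{1..n}. indicator {K..} (Y i))" for Y
  proof (cases "\<forall>i\<in>{1..n}. Y i < K")
    case True
    then have "pmf (empirical_pmf n Y) y = 0" if "K \<le> y" for y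
      using that set_empirical_pmf[OF n, of Y] by (force simp: pmf_eq_0_set_pmf)
    then have "chi_sq (empirical_pmf n Y) ?p \<le> (\<Sum>y<K. ?t Y y) + ennreal \<epsilon>"
      using order_trans[OF chi_sq_le_truncated add_left_mono[OF tail']] by blast
    moreover have "?H Y \<le> ?C * chi_sq (empirical_pmf n Y) ?p"
      by (rule hellinger_sq_estimator_le[OF d \<kappa> _ G]) (simp add: set_empirical_pmf[OF n])
    ultimately have "?H Y \<le> ?C * ((\<Sum>y<K. ?t Y y) + ennreal \<epsilon>)"
      using order_trans mult_left_mono[of _ _ ?C] by fastforce
    then show ?thesis by (rule add_increasing2[rotated]) simp
  next
    case False
    then obtain i where i: "i \<in> {1..n}" "K \<le> Y i" by (auto simp: not_less)
    have "1 \<le> (\<Sum>i\<in>{1..n}. indicator {K..} (Y i) :: ennreal)"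
      using sum_mono2[of "{1..n}" "{i}" "\<lambda>i. indicator {K..} (Y i) :: ennreal"] i by auto
    then have "2 * 1 \<le> 2 * (\<Sum>i\<in>{1..n}. indicator {K..} (Y i) :: ennreal)"
      by (rule mult_left_mono) simp
    then have "?H Y \<le> 2 * (\<Sum>i\<in>{1..n}. indicator {K..} (Y i))"
      using order_trans[OF hellinger_sq_le_2] by simp
    then show ?thesis by (rule add_increasing[rotated]) simp
  qed
  \<comment> \<open>Together with the sum over \<open>i\<close>, this is the union bound for the bad
    event.\<close>
  have comp: "(\<integral>\<^sup>+ Y. indicator {K..} (Y i) \<partial>measure_pmf ?P) \<le> ennreal \<epsilon>" if "i \<in> {1..n}" for i
  proof -
    have "(\<integral>\<^sup>+ Y. indicator {K..} (Y i) \<partial>measure_pmf ?P)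
        = (\<integral>\<^sup>+ y. indicator {K..} y \<partial>measure_pmf (map_pmf (\<lambda>Y. Y i) ?P))"
      by simp
    also have "\<dots> = emeasure (measure_pmf ?p) {K..}"
      using that by (subst Pi_pmf_component) auto
    finally show ?thesis using tail' by simp
  qed
  have "hellinger_risk d n G
      \<le> (\<integral>\<^sup>+ Y. ?C * ((\<Sum>y<K. ?t Y y) + ennreal \<epsilon>) + 2 * (\<Sum>i\<in>{1..n}. indicator {K..} (Y i)) \<partial>measure_pmf ?P)"
    unfolding hellinger_risk_def by (intro nn_integral_mono pointwise)
  also have "\<dots> = ?C * ((\<Sum>y<K. \<integral>\<^sup>+ Y. ?t Y y \<partial>measure_pmf ?P) + ennreal \<epsilon>)
      + 2 * (\<Sum>i\<in>{1..n}. \<integral>\<^sup>+ Y. indicator {K..} (Y i) \<partial>measure_pmf ?P)"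
    by (simp add: nn_integral_add nn_integral_cmult nn_integral_sum measure_pmf.emeasure_space_1[simplified])
  also have "\<dots> \<le> ?C * ((\<Sum>y<K. ennreal (1 / n)) + ennreal \<epsilon>) + 2 * (\<Sum>i\<in>{1..n}. ennreal \<epsilon>)"
    by (intro add_mono mult_left_mono sum_mono nn_integral_empirical_chi_term[OF n] comp) auto
  also have "\<dots> = ennreal (4 * \<kappa>2 / \<kappa>1 * (K / n + \<epsilon>) + 2 * real n * \<epsilon>)"
  proof -
    have "(\<Sum>y<K. ennreal (1 / n)) = ennreal (K / n)"
      by (simp add: ennreal_of_nat_eq_real_of_nat flip: ennreal_mult)
    moreover have "(\<Sum>i\<in>{1..n}. ennreal \<epsilon>) = ennreal (n * \<epsilon>)"
      using \<epsilon> by (simp add: ennreal_of_nat_eq_real_of_nat ennreal_mult)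
    moreover have "2 * ennreal (n * \<epsilon>) = ennreal (2 * real n * \<epsilon>)"
      using \<epsilon> by (simp add: ennreal_mult mult.assoc)
    ultimately show ?thesis
      using \<epsilon> \<kappa> by (simp flip: ennreal_plus ennreal_mult)
  qed
  finally show ?thesis .
qed

text \<open>With tail mass of order \<open>1 / n\<^sup>2\<close> the union bound costs only order
  \<open>1 / n\<close>. The numerator 3 leaves room for the constant 2 in \<open>SubE\<close> and 1
  for a Chernoff term.\<close>

lemma hellinger_risk_le:
  fixes \<kappa>1 \<kappa>2 :: real
  assumes d: "decomposition_property d" "sandwich_property \<kappa>1 \<kappa>2 d" and \<kappa>: "0 < \<kappa>1" "0 < \<kappa>2"
    and n: "1 \<le> n" and G: "G \<in> prob_measures_on {0..}"
    and tail: "measure (measure_pmf (poisson_mixture G)) {K..} \<le> 3 / (real n)\<^sup>2"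
  shows "hellinger_risk d n G \<le> ennreal ((4 * \<kappa>2 / \<kappa>1 + 2) * (real K + 3) / n)"
proof -
  have n2: "3 / (real n)\<^sup>2 \<le> 3 / n"
    using n by (simp add: field_simps power2_eq_square)
  have "4 * \<kappa>2 / \<kappa>1 * (K / n + 3 / (real n)\<^sup>2) \<le> 4 * \<kappa>2 / \<kappa>1 * (K / n + 3 / n)"
    using n2 \<kappa> by (intro mult_left_mono) auto
  moreover have "2 * real n * (3 / (real n)\<^sup>2) = 2 * (3 / n)"
    using n by (simp add: power2_eq_square)
  moreover have "2 * (3 / n) \<le> 2 * ((real K + 3) / n)"
    by (intro mult_left_mono divide_right_mono) auto
  ultimately have "4 * \<kappa>2 / \<kappa>1 * (K / n + 3 / (real n)\<^sup>2) + 2 * real n * (3 / (real n)\<^sup>2)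
      \<le> 4 * \<kappa>2 / \<kappa>1 * ((real K + 3) / n) + 2 * ((real K + 3) / n)"
    unfolding add_divide_distrib[of "real K" 3] by linarith
  also have "\<dots> = (4 * \<kappa>2 / \<kappa>1 + 2) * (real K + 3) / n"
    by (simp only: distrib_right times_divide_eq_right add_divide_distrib[of "x * y" for x y])
  finally show ?thesis
    using hellinger_risk_truncation[OF d \<kappa> n G tail] ennreal_leI order_trans by blast
qed

section \<open>Truncation levels for the two classes of mixing measures\<close>

lemma prob_measures_on_subset:
  assumes "G \<in> prob_measures_on A" "A \<subseteq> B" "B \<in> sets borel"
  shows "G \<in> prob_measures_on B"
proof -
  interpret real_distribution G using assms by (simp add: prob_measures_on_def)
  have "measure G A \<le> measure G B" using assms by (intro finite_measure_mono) auto
  then show ?thesis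
    using assms antisym[OF prob_le_1, of B] by (simp add: prob_measures_on_def)
qed

text \<open>Splitting at \<open>a = h\<close> leaves only the Chernoff term, since no mixing mass
  lies beyond \<open>h\<close>.\<close>

lemma poisson_mixture_tail_bounded_support:
  assumes G: "G \<in> prob_measures_on {0..h}" and x: "1 \<le> x"
  shows "measure (measure_pmf (poisson_mixture G)) {K..} \<le> exp (h * (x - 1)) / x ^ K"
proof -
  interpret real_distribution G using G by (simp add: prob_measures_on_def)
  have "measure G {0..h} + measure G {h<..} = measure G ({0..h} \<union> {h<..})"
    by (rule finite_measure_Union[symmetric]) auto
  then have "measure G {h<..} \<le> 0"
    using G prob_le_1[of "{0..h} \<union> {h<..}"] unfolding prob_measures_on_def mem_Collect_eq by linarith
  moreover have "G \<in> prob_measures_on {0..}"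
    by (rule prob_measures_on_subset[OF G]) auto
  ultimately show ?thesis
    using measure_poisson_mixture_tail[OF _ x, of G K h] by linarith
qed

text \<open>Chernoff's bound with \<open>x = exp 1\<close>: since \<open>exp 1 \<le> 3\<close>, the
  exponent is at most \<open>2 * a - K\<close>. In the applications \<open>L\<close> is
  \<open>ln n\<close>, so the right side is \<open>1 / n\<^sup>2\<close>.\<close>

lemma tail_exp_le:
  assumes "0 \<le> a" "2 * a + 2 * L \<le> real K"
  shows "exp (a * (exp 1 - 1)) / exp 1 ^ K \<le> exp (- 2 * L)"
proof -
  have "a * (exp 1 - 1) \<le> a * 2"
    using assms(1) exp_le by (intro mult_left_mono) auto
  then have "exp (a * (exp 1 - 1) - K) \<le> exp (- 2 * L)"
    using assms(2) by simp
  then show ?thesis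
    by (simp add: exp_diff flip: exp_of_nat_mult)
qed

lemma exp_neg_2_ln: "0 < n \<Longrightarrow> exp (- 2 * ln (real n)) = 1 / (real n)\<^sup>2"
  by (simp add: exp_minus exp_double inverse_eq_divide)

text \<open>Chernoff's bound with \<open>x = L\<close>, which is where the iterated logarithm comes
  from: \<open>K * ln L\<close> is at least \<open>3 * m * L\<close>, of which one third pays for
  \<open>h * (L - 1)\<close> and the rest exceeds \<open>2 * L\<close>.\<close>

lemma tail_log_over_loglog_le:
  assumes h: "h \<le> m" and m: "1 \<le> m" and L: "1 < L" and K: "3 * (m * (L / ln L)) \<le> real K"
  shows "exp (h * (L - 1)) / L ^ K \<le> exp (- 2 * L)"
proof -
  have l: "0 < ln L" using L by simp
  have "h * (L - 1) \<le> m * L"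
    using h m L by (intro mult_mono) auto
  moreover have "3 * (m * L) \<le> K * ln L"
    using mult_right_mono[OF K, of "ln L"] l by simp
  moreover have "L \<le> m * L" using m L by simp
  ultimately have "h * (L - 1) - K * ln L \<le> - 2 * L" by linarith
  then have "exp (h * (L - 1) - K * ln L) \<le> exp (- 2 * L)" by simp
  moreover have "L ^ K = exp (K * ln L)" using L by (simp add: exp_of_nat_mult)
  ultimately show ?thesis by (simp add: exp_diff)
qed

lemma nat_ceiling_le: "0 \<le> x \<Longrightarrow> real (nat \<lceil>x\<rceil>) \<le> x + 1"
  by linarith

text \<open>This makes \<open>ln (ln n)\<close> positive for \<open>n \<ge> 3\<close>.\<close>

lemma one_less_ln: "3 \<le> x \<Longrightarrow> 1 < ln (x::real)"
  using e_less_272 ln_less_cancel_iff[of "exp 1" x] by simp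

theorem theorem2:
  fixes \<kappa>1 \<kappa>2 :: real
  assumes "\<kappa>1 > 0" and "\<kappa>2 > 0"
  shows "\<exists>c1 c2 :: real.
    \<forall>d :: nat pmf \<Rightarrow> nat pmf \<Rightarrow> ennreal.
      generalized_distance d \<and> decomposition_property d \<and> sandwich_property \<kappa>1 \<kappa>2 d \<longrightarrow>
      (\<forall>(h::real)>0. \<forall>(s::real)>0.
        (\<forall>n\<ge>3. (SUP G \<in> prob_measures_on {0..h}. hellinger_risk d n G)
            \<le> ennreal (c1 / real n *
                 min (max 1 h * (ln (real n) / ln (ln (real n)))) (h + ln (real n)))) \<and>
        (\<forall>n\<ge>2. (SUP G \<in> SubE s. hellinger_risk d n G)
            \<le> ennreal (c2 * max 1 s / real n * ln (real n))))"
proof -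
  \<comment> \<open>The factor from \<open>hellinger_risk_le\<close>. It depends only on
    \<open>\<kappa>1\<close> and \<open>\<kappa>2\<close>, so the final constants can be fixed
    before \<open>d\<close>.\<close>
  define C where "C = 4 * \<kappa>2 / \<kappa>1 + 2"
  have C: "0 \<le> C" using assms by (simp add: C_def)
  \<comment> \<open>With \<open>R\<close> the target rate times \<open>n\<close>, only a level
    \<open>K\<close> of order \<open>R\<close> with a small enough tail remains to be found.\<close>
  have risk: "hellinger_risk d n G \<le> ennreal (c * C / n * R)"
    if d: "decomposition_property d" "sandwich_property \<kappa>1 \<kappa>2 d"
      and n: "1 \<le> n" and G: "G \<in> prob_measures_on {0..}"
      and tail: "measure (measure_pmf (poisson_mixture G)) {K..} \<le> 3 / (real n)\<^sup>2"
      and K: "real K + 3 \<le> c * R" for d n G K c R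
  proof -
    have "C * (real K + 3) / n \<le> C * (c * R) / n"
      using K C by (intro divide_right_mono mult_left_mono) auto
    then show ?thesis
      using hellinger_risk_le[OF d assms n G tail] ennreal_leI order_trans
      by (fastforce simp: C_def mult_ac)
  qed
  have bounded: "hellinger_risk d n G \<le> ennreal (7 * C / n *
      min (max 1 h * (ln (real n) / ln (ln (real n)))) (h + ln (real n)))"
    if d: "decomposition_property d" "sandwich_property \<kappa>1 \<kappa>2 d"
      and h: "0 < h" and n: "3 \<le> n" and G: "G \<in> prob_measures_on {0..h}" for d h n G
  proof -
    define L where "L = ln (real n)"
    have L: "1 < L" unfolding L_def using n by (intro one_less_ln) auto
    have sq: "exp (- 2 * L) \<le> 3 / (real n)\<^sup>2"
      using n by (simp only: L_def exp_neg_2_ln) (simp add: divide_right_mono)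
    have G0: "G \<in> prob_measures_on {0..}"
      by (rule prob_measures_on_subset[OF G]) auto
    note tail = poisson_mixture_tail_bounded_support[OF G]
    define R where "R = max 1 h * (L / ln L)"
    have bound: "hellinger_risk d n G \<le> ennreal (7 * C / n * R)"
    proof (rule risk[OF d _ G0])
      have l: "0 < ln L" "ln L \<le> L" using L less_imp_le[OF ln_less_self[of L]] by auto
      then have "1 * 1 \<le> R" unfolding R_def by (intro mult_mono) auto
      \<comment> \<open>As \<open>R \<ge> 1\<close>, the rounding error 1 and the additive 3 fit
        into \<open>4 * R\<close>; with the level \<open>3 * R\<close> this gives the constant
        7.\<close>
      then show "real (nat \<lceil>3 * R\<rceil>) + 3 \<le> 7 * R" using nat_ceiling_le[of "3 * R"] by linarith
      show "measure (measure_pmf (poisson_mixture G)) {nat \<lceil>3 * R\<rceil>..} \<le> 3 / (real n)\<^sup>2"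
        using tail[of L "nat \<lceil>3 * R\<rceil>"] sq L real_nat_ceiling_ge[of "3 * R"]
          tail_log_over_loglog_le[of h "max 1 h" L "nat \<lceil>3 * R\<rceil>", folded R_def] by linarith
    qed (use n in simp)
    \<comment> \<open>The second rate uses \<open>x = exp 1\<close> and the level
      \<open>2 * R'\<close>; the same constant 7 is kept so that the two bounds combine into a
      minimum.\<close>
    define R' where "R' = h + L"
    have R': "1 \<le> R'" using h L by (simp add: R'_def)
    have "hellinger_risk d n G \<le> ennreal (7 * C / n * R')"
    proof (rule risk[OF d _ G0])
      show "real (nat \<lceil>2 * R'\<rceil>) + 3 \<le> 7 * R'"
        using nat_ceiling_le[of "2 * R'"] R' by linarith
      show "measure (measure_pmf (poisson_mixture G)) {nat \<lceil>2 * R'\<rceil>..} \<le> 3 / (real n)\<^sup>2"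
        using tail[of "exp 1" "nat \<lceil>2 * R'\<rceil>"] sq h real_nat_ceiling_ge[of "2 * R'"]
          tail_exp_le[of h L "nat \<lceil>2 * R'\<rceil>"] by (simp add: R'_def)
    qed (use n in simp)
    with bound have "hellinger_risk d n G \<le> ennreal (7 * C / n * min R R')"
      by (simp add: min_def)
    then show ?thesis unfolding R_def R'_def L_def .
  qed
  have subexp: "hellinger_risk d n G \<le> ennreal (14 * C * max 1 s / n * ln (real n))"
    if d: "decomposition_property d" "sandwich_property \<kappa>1 \<kappa>2 d"
      and s: "0 < s" and n: "2 \<le> n" and G: "G \<in> SubE s" for d s n G
  proof -
    define L where "L = ln (real n)"
    have "ln 2 \<le> L" unfolding L_def using n by (subst ln_le_cancel_iff) auto
    \<comment> \<open>For \<open>n = 2\<close> the logarithm is below one, so only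
      \<open>R \<ge> 1 / 2\<close> is available, and absorbing the additive 4 takes
      \<open>8 * R\<close>; hence 14 as 6 plus 8.\<close>
    then have L: "1 / 2 \<le> L" using ln2_ge_two_thirds by linarith
    have sq: "exp (- 2 * L) = 1 / (real n)\<^sup>2"
      using n by (simp only: L_def exp_neg_2_ln)
    have G0: "G \<in> prob_measures_on {0..}" using G by (simp add: SubE_def)
    interpret real_distribution G using G0 by (simp add: prob_measures_on_def)
    define R where "R = max 1 s * L"
    \<comment> \<open>The split point at which the subexponential tail bound equals
      \<open>2 / n\<^sup>2\<close>.\<close>
    let ?a = "2 * s * L"
    have R: "s * L \<le> R" "L \<le> R" using L unfolding R_def by (auto intro!: mult_right_mono simp: max_def)
    have "hellinger_risk d n G \<le> ennreal (14 * C / n * R)"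
    proof (rule risk[OF d _ G0])
      show "real (nat \<lceil>6 * R\<rceil>) + 3 \<le> 14 * R" using nat_ceiling_le[of "6 * R"] L R by linarith
      have "measure G {?a<..} \<le> measure G {?a..}" by (intro finite_measure_mono) auto
      also have "\<dots> \<le> 2 * exp (- ?a / s)"
      proof -
        have "\<forall>t>0. measure G {t..} \<le> 2 * exp (- t / s)" using G unfolding SubE_def by blast
        moreover have "0 < ?a" using s L by simp
        ultimately show ?thesis by blast
      qed
      also have "- ?a / s = - 2 * L" using s by simp
      finally have "measure G {?a<..} \<le> 2 / (real n)\<^sup>2" by (simp add: sq[simplified])
      \<comment> \<open>The level \<open>6 * R\<close> is what \<open>tail_exp_le\<close> asks for:
        \<open>2 * ?a + 2 * L\<close> is \<open>4 * s * L + 2 * L\<close>.\<close>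
      moreover have "exp (?a * (exp 1 - 1)) / exp 1 ^ nat \<lceil>6 * R\<rceil> \<le> 1 / (real n)\<^sup>2"
        unfolding sq[symmetric] using s L R real_nat_ceiling_ge[of "6 * R"]
        by (intro tail_exp_le) (simp, linarith)
      moreover note measure_poisson_mixture_tail[OF G0, of "exp 1" "nat \<lceil>6 * R\<rceil>" ?a]
      ultimately have "measure (measure_pmf (poisson_mixture G)) {nat \<lceil>6 * R\<rceil>..} \<le> 2 / (real n)\<^sup>2 + 1 / (real n)\<^sup>2"
        by simp
      then show "measure (measure_pmf (poisson_mixture G)) {nat \<lceil>6 * R\<rceil>..} \<le> 3 / (real n)\<^sup>2"
        by (simp flip: add_divide_distrib)
    qed (use n in simp)
    then show ?thesis by (simp add: L_def R_def mult_ac)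
  qed
  show ?thesis
    by (rule exI[of _ "7 * C"], rule exI[of _ "14 * C"])
      (intro allI impI conjI SUP_least; elim conjE; rule bounded subexp; assumption)
qed

end
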